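(* For every $n\ge 1$ there exists an $(n+1)$-dimensional partially ordered real vector space $(X,K)$ with a closed generating polyhedral cone $K$ that has exactly $\binom{2n}{n}+2$ bands. In particular, for every $n\ge 4$ there exists an $n$-dimensional partially ordered real vector space that has more bands than an $n$-dimensional Archimedean vector lattice, which has $2^n$ bands.
   Context: A cone $K$ in a real vector space $X$ is a subset closed under addition and multiplication by nonnegative scalars with $K\cap(-K)=\{0\}$; $(X,K)$ denotes $X$ partially ordered by $x\le y$ iff $y-x\in K$. $K$ is generating if $X=K-K$; a closed cone in a finite dimensional space is polyhedral if it is the intersection of finitely many closed half-spaces. For $M\subseteq X$, $M^u$ is the set of upper bounds of $M$ in $X$. Elements $x,y\in X$ are disjoint, $x\perp y$, if $\{x+y,-x-y\}^u=\{x-y,-x+y\}^u$. The disjoint complement of $M\subseteq X$ is $M^d=\{y\in X\colon x\perp y\text{ for all }x\in M\}$. A linear subspace $B\subseteq X$ is a band if $(B^d)^d=B$. *)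

theory Defs
  imports "HOL-Analysis.Analysis" "HOL-Analysis.Finite_Function_Topology"
begin

(* A partially ordered vector space (X, K) is a linear subspace X of an ambient real vector
   space together with a cone K in X; x \<le> y means y - x \<in> K. All notions below are
   relative to X. *)

definition order_cone :: "'a::real_vector set \<Rightarrow> bool" where
  "order_cone K \<longleftrightarrow>
     (\<forall>x\<in>K. \<forall>y\<in>K. x + y \<in> K) \<and>
     (\<forall>c\<ge>0. \<forall>x\<in>K. c *\<^sub>R x \<in> K) \<and>
     K \<inter> uminus ` K = {0}"

definition povs :: "'a::real_vector set \<Rightarrow> 'a set \<Rightarrow> bool" where
  "povs X K \<longleftrightarrow> subspace X \<and> K \<subseteq> X \<and> order_cone K"

definition generating_cone :: "'a::real_vector set \<Rightarrow> 'a set \<Rightarrow> bool" where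
  "generating_cone X K \<longleftrightarrow> X = {x - y | x y. x \<in> K \<and> y \<in> K}"

(* Every linear functional on X is the restriction of a linear functional on the ambient space.
   For finite dimensional X all these half-spaces are closed in X. *)
definition half_space :: "'a::real_vector set \<Rightarrow> 'a set \<Rightarrow> bool" where
  "half_space X H \<longleftrightarrow>
     (\<exists>f c. linear f \<and> (\<exists>x\<in>X. f x \<noteq> (0::real)) \<and> H = {x \<in> X. f x \<le> c})"

definition polyhedral_cone :: "'a::real_vector set \<Rightarrow> 'a set \<Rightarrow> bool" where
  "polyhedral_cone X K \<longleftrightarrow> (\<exists>F. finite F \<and> (\<forall>H\<in>F. half_space X H) \<and> K = X \<inter> \<Inter>F)"

definition upper_bounds :: "'a::real_vector set \<Rightarrow> 'a set \<Rightarrow> 'a set \<Rightarrow> 'a set" where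
  "upper_bounds X K M = {z \<in> X. \<forall>m\<in>M. z - m \<in> K}"

definition disjoint_elems :: "'a::real_vector set \<Rightarrow> 'a set \<Rightarrow> 'a \<Rightarrow> 'a \<Rightarrow> bool" where
  "disjoint_elems X K x y \<longleftrightarrow>
     upper_bounds X K {x + y, - x - y} = upper_bounds X K {x - y, - x + y}"

definition disjoint_complement :: "'a::real_vector set \<Rightarrow> 'a set \<Rightarrow> 'a set \<Rightarrow> 'a set" where
  "disjoint_complement X K M = {y \<in> X. \<forall>x\<in>M. disjoint_elems X K x y}"

definition bands :: "'a::real_vector set \<Rightarrow> 'a set \<Rightarrow> 'a set set" where
  "bands X K =
     {B. subspace B \<and> B \<subseteq> X \<and>
         disjoint_complement X K (disjoint_complement X K B) = B}"

definition archimedean_povs :: "'a::real_vector set \<Rightarrow> 'a set \<Rightarrow> bool" where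
  "archimedean_povs X K \<longleftrightarrow>
     povs X K \<and> (\<forall>x\<in>X. \<forall>y\<in>X. (\<forall>k::nat. y - real k *\<^sub>R x \<in> K) \<longrightarrow> - x \<in> K)"

(* Binary infima exist as well, since inf x y = - sup (-x) (-y). *)
definition vector_lattice :: "'a::real_vector set \<Rightarrow> 'a set \<Rightarrow> bool" where
  "vector_lattice X K \<longleftrightarrow>
     povs X K \<and>
     (\<forall>x\<in>X. \<forall>y\<in>X. \<exists>s\<in>upper_bounds X K {x, y}. \<forall>u\<in>upper_bounds X K {x, y}. u - s \<in> K)"

end

(* If a polyhedral cone is cut out by irredundant functionals f_i, then x and y are disjoint iff
   f_i(x) f_i(y) = 0 for all i, so a disjoint complement is the common kernel of some of the f_i.
   On the polynomials of degree at most n take the evaluations at 2n distinct nodes. A nonzero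
   polynomial vanishes at no more than n nodes, so two nonzero polynomials are disjoint only if each
   vanishes at exactly n nodes and these two sets are complementary. The bands besides 0 and the
   whole space are therefore the lines of polynomials vanishing at a given n-subset of the nodes.

   In a finite dimensional Archimedean vector lattice, a maximal family of disjoint nonzero positive
   elements is a basis, and the positive cone consists of the nonnegative combinations. Hence every
   set of coordinates gives a band. *)
theory Submission
  imports Defs
begin

subsection \<open>Cones with irredundant facets\<close>

locale facet_cone =
  fixes X :: "'a::real_vector set" and I :: "'i set"
    and f :: "'i \<Rightarrow> 'a \<Rightarrow> real" and p :: "'i \<Rightarrow> 'a"
  assumes subspace_X: "subspace X"
    and finite_I: "finite I"
    and linear_f: "linear (f i)"
    and p_in: "i \<in> I \<Longrightarrow> p i \<in> X"
    and p_zero: "i \<in> I \<Longrightarrow> f i (p i) = 0"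
    and p_pos: "i \<in> I \<Longrightarrow> j \<in> I \<Longrightarrow> j \<noteq> i \<Longrightarrow> f j (p i) > 0"
begin

definition K :: "'a set" where
  "K = {x \<in> X. \<forall>i\<in>I. f i x \<ge> 0}"

definition V :: "'i set \<Rightarrow> 'a set" where
  "V S = {x \<in> X. \<forall>i\<in>S. f i x = 0}"

lemmas X_closed = subspace_0[OF subspace_X] subspace_add[OF subspace_X]
  subspace_diff[OF subspace_X] subspace_neg[OF subspace_X] subspace_scale[OF subspace_X]

lemmas f_simps = linear_0[OF linear_f] linear_add[OF linear_f] linear_diff[OF linear_f]
  linear_neg[OF linear_f] linear_scale[OF linear_f]

lemma subspace_V: "subspace (V S)"
  unfolding subspace_def V_def by (auto simp: f_simps X_closed)

lemma V_subset: "V S \<subseteq> X"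
  by (auto simp: V_def)

section \<open>Upper bounds and disjointness read off from the facet functionals\<close>

lemma upper_bounds_abs:
  assumes "a \<in> X"
  shows "upper_bounds X K {a, - a} = {z \<in> X. \<forall>i\<in>I. \<bar>f i a\<bar> \<le> f i z}"
  using assms unfolding upper_bounds_def K_def
  by (auto simp: f_simps X_closed abs_le_iff minus_le_iff)

text \<open>The facet functionals are irredundant: moving far along \<open>p i\<close> makes all constraints but the
  \<open>i\<close>-th one slack.\<close>

lemma upper_bound_touching:
  assumes "a \<in> X" "i \<in> I"
  shows "\<exists>z\<in>upper_bounds X K {a, - a}. f i z = \<bar>f i a\<bar>"
proof -
  \<comment> \<open>The summand of \<open>j\<close> alone gives \<open>s * f j (p i)\<close> at
    least \<open>2 * abs (f j a)\<close>: one half offsets a negative contribution of the signed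
    copy of \<open>a\<close>, the other half remains as the required bound.\<close>
  define s where "s = (\<Sum>j\<in>I - {i}. 2 * \<bar>f j a\<bar> / f j (p i))"
  define z where "z = sgn (f i a) *\<^sub>R a + s *\<^sub>R p i"
  have zX: "z \<in> X"
    using assms by (simp add: z_def X_closed p_in)
  have fi: "f i z = \<bar>f i a\<bar>"
    using assms by (simp add: z_def f_simps p_zero abs_sgn mult.commute)
  have "\<bar>f j a\<bar> \<le> f j z" if "j \<in> I" for j
  proof (cases "j = i")
    case False
    have pos: "f j (p i) > 0"
      using False p_pos assms that by blast
    have "2 * \<bar>f j a\<bar> / f j (p i) \<le> s"
      unfolding s_def using False that assms finite_I
      by (intro member_le_sum) (auto intro!: divide_nonneg_nonneg less_imp_le[OF p_pos])
    hence "2 * \<bar>f j a\<bar> \<le> s * f j (p i)"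
      using pos by (simp add: pos_divide_le_eq)
    moreover have "\<bar>sgn (f i a) * f j a\<bar> \<le> \<bar>f j a\<bar>"
      by (simp add: abs_mult sgn_if)
    ultimately show ?thesis
      by (simp add: z_def f_simps)
  qed (simp add: fi)
  with zX fi show ?thesis
    unfolding upper_bounds_abs[OF assms(1)] by blast
qed

text \<open>By the touching bounds, \<open>abs (f i a)\<close> is the minimum of \<open>f i\<close>
  over the upper bounds of \<open>a\<close> and \<open>- a\<close>, so inclusion is decided facet by
  facet.\<close>

lemma upper_bounds_abs_le_iff:
  assumes "a \<in> X" "b \<in> X"
  shows "upper_bounds X K {a, - a} \<subseteq> upper_bounds X K {b, - b} \<longleftrightarrow> (\<forall>i\<in>I. \<bar>f i b\<bar> \<le> \<bar>f i a\<bar>)"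
proof
  assume "upper_bounds X K {a, - a} \<subseteq> upper_bounds X K {b, - b}"
  then show "\<forall>i\<in>I. \<bar>f i b\<bar> \<le> \<bar>f i a\<bar>"
    using upper_bound_touching[OF assms(1)] upper_bounds_abs[OF assms(2)] by fastforce
next
  assume "\<forall>i\<in>I. \<bar>f i b\<bar> \<le> \<bar>f i a\<bar>"
  then show "upper_bounds X K {a, - a} \<subseteq> upper_bounds X K {b, - b}"
    unfolding upper_bounds_abs[OF assms(1)] upper_bounds_abs[OF assms(2)] by force
qed

text \<open>Both sets of upper bounds belong to a pair \<open>a\<close>, \<open>- a\<close>, and
  reals satisfy \<open>abs (s + t) = abs (s - t)\<close> exactly when
  \<open>s * t = 0\<close>.\<close>

lemma disjoint_elems_iff:
  assumes "x \<in> X" "y \<in> X"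
  shows "disjoint_elems X K x y \<longleftrightarrow> (\<forall>i\<in>I. f i x * f i y = 0)"
proof -
  have "disjoint_elems X K x y \<longleftrightarrow>
      upper_bounds X K {x + y, - (x + y)} = upper_bounds X K {x - y, - (x - y)}"
    by (simp add: disjoint_elems_def)
  also have "\<dots> \<longleftrightarrow> (\<forall>i\<in>I. \<bar>f i (x + y)\<bar> = \<bar>f i (x - y)\<bar>)"
    unfolding set_eq_subset upper_bounds_abs_le_iff[OF X_closed(2)[OF assms] X_closed(3)[OF assms]]
      upper_bounds_abs_le_iff[OF X_closed(3)[OF assms] X_closed(2)[OF assms]]
    by (auto intro: antisym)
  also have "\<dots> \<longleftrightarrow> (\<forall>i\<in>I. f i x * f i y = 0)"
    by (auto simp: f_simps abs_eq_iff)
  finally show ?thesis .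
qed

lemma disjoint_complement_eq_V:
  assumes "M \<subseteq> X"
  shows "disjoint_complement X K M = V {i \<in> I. \<exists>x\<in>M. f i x \<noteq> 0}"
  using assms unfolding disjoint_complement_def V_def
  by (fastforce simp: disjoint_elems_iff subset_iff)

section \<open>Order properties of the cone\<close>

lemma K_subset: "K \<subseteq> X"
  by (auto simp: K_def)

lemma zero_in_K: "0 \<in> K"
  by (simp add: K_def f_simps X_closed)

text \<open>Separation of points by the functionals makes the cone pointed.\<close>

lemma povs_K:
  assumes "\<And>x. x \<in> X \<Longrightarrow> (\<And>i. i \<in> I \<Longrightarrow> f i x = 0) \<Longrightarrow> x = 0"
  shows "povs X K"
proof -
  have "x = 0" if "x \<in> K" "- x \<in> K" for x
  proof (rule assms)
    fix i assume "i \<in> I"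
    with that have "f i x \<ge> 0" "f i (- x) \<ge> 0"
      by (auto simp: K_def)
    then show "f i x = 0"
      by (simp add: f_simps)
  qed (use that in \<open>simp add: K_def\<close>)
  then have "K \<inter> uminus ` K = {0}"
    using zero_in_K by (auto simp: image_iff)
  then show ?thesis
    using subspace_X unfolding povs_def order_cone_def
    by (auto simp: K_def f_simps X_closed)
qed

text \<open>The element \<open>w\<close> is an order unit: for large \<open>s\<close> both
  \<open>x + s *\<^sub>R w\<close> and \<open>s *\<^sub>R w\<close> lie in \<open>K\<close>.\<close>

lemma generating_K:
  assumes "w \<in> X" "\<And>i. i \<in> I \<Longrightarrow> f i w > 0"
  shows "generating_cone X K"
proof -
  have "\<exists>a\<in>K. \<exists>b\<in>K. x = a - b" if "x \<in> X" for x
  proof -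
    define s where "s = (\<Sum>i\<in>I. \<bar>f i x\<bar> / f i w)"
    have "\<bar>f i x\<bar> \<le> s * f i w" if "i \<in> I" for i
    proof -
      have "\<bar>f i x\<bar> / f i w \<le> s"
        unfolding s_def using that finite_I assms
        by (intro member_le_sum) (auto intro!: divide_nonneg_pos)
      then show ?thesis
        using assms that by (simp add: pos_divide_le_eq)
    qed
    moreover have "s \<ge> 0"
      unfolding s_def using assms by (intro sum_nonneg) (auto intro!: divide_nonneg_pos)
    ultimately have "x + s *\<^sub>R w \<in> K" "s *\<^sub>R w \<in> K"
      using assms \<open>x \<in> X\<close> by (fastforce simp: K_def f_simps X_closed intro: less_imp_le)+
    moreover have "x = (x + s *\<^sub>R w) - s *\<^sub>R w"
      by simp
    ultimately show ?thesis by blast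
  qed
  then show ?thesis
    unfolding generating_cone_def using K_subset by (auto intro: X_closed(3)) blast
qed

text \<open>A half-space requires a functional that is not identically zero on \<open>X\<close>,
  which \<open>w\<close> witnesses.\<close>

lemma polyhedral_K:
  assumes "w \<in> X" "\<And>i. i \<in> I \<Longrightarrow> f i w > 0"
  shows "polyhedral_cone X K"
proof -
  define F where "F = (\<lambda>i. {x \<in> X. - f i x \<le> 0}) ` I"
  have "half_space X {x \<in> X. - f i x \<le> 0}" if "i \<in> I" for i
    unfolding half_space_def using assms that
    by (intro exI[of _ "\<lambda>x. - f i x"] exI[of _ 0])
      (force intro!: linear_compose_neg linear_f bexI[of _ w])
  moreover have "K = X \<inter> \<Inter>F"
    by (auto simp: F_def K_def)
  ultimately show ?thesis
    unfolding polyhedral_cone_def by (intro exI[of _ F]) (auto simp: F_def finite_I)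
qed

end

text \<open>Meant for vector lattices. The \<open>e i\<close> are dual to the functionals up to
  scaling, so \<open>V\<close> is injective on subsets of \<open>I\<close> and turns set complements
  into disjoint complements.\<close>

lemma (in facet_cone) card_bands_pow:
  assumes e: "\<And>i. i \<in> I \<Longrightarrow> e i \<in> X" "\<And>i j. i \<in> I \<Longrightarrow> j \<in> I \<Longrightarrow> f j (e i) \<noteq> 0 \<longleftrightarrow> j = i"
  shows "card (bands X K) = 2 ^ card I"
proof -
  have e_in_V: "e i \<in> V S \<longleftrightarrow> i \<notin> S" if "i \<in> I" "S \<subseteq> I" for i S
  proof -
    have "\<forall>j\<in>S. f j (e i) = 0 \<longleftrightarrow> j \<noteq> i"
      using e(2) that by blast
    then show ?thesis
      using e(1)[OF that(1)] by (auto simp: V_def)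
  qed
  have compl: "disjoint_complement X K (V S) = V (I - S)" if "S \<subseteq> I" for S
  proof -
    have "(\<exists>x\<in>V S. f i x \<noteq> 0) \<longleftrightarrow> i \<notin> S" if "i \<in> I" for i
      using e_in_V[OF that \<open>S \<subseteq> I\<close>] e(2)[OF that that] by (auto simp: V_def)
    then have "{i \<in> I. \<exists>x\<in>V S. f i x \<noteq> 0} = I - S"
      by blast
    then show ?thesis
      by (simp add: disjoint_complement_eq_V V_subset)
  qed
  have "V S \<in> bands X K" if "S \<subseteq> I" for S
  proof -
    have "I - (I - S) = S" using that by blast
    then show ?thesis
      using compl[OF that] compl[of "I - S"] V_subset by (simp add: bands_def subspace_V)
  qed
  \<comment> \<open>A band is the disjoint complement of its own disjoint complement, hence a common
    kernel.\<close>
  moreover have "B \<in> V ` Pow I" if "B \<in> bands X K" for B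
  proof -
    have B: "disjoint_complement X K (disjoint_complement X K B) = B"
      using that by (simp add: bands_def)
    have "disjoint_complement X K B \<subseteq> X"
      by (auto simp: disjoint_complement_def)
    from disjoint_complement_eq_V[OF this] show ?thesis
      unfolding B by blast
  qed
  ultimately have bands: "bands X K = V ` Pow I"
    by blast
  have "inj_on V (Pow I)"
  proof (rule inj_onI)
    fix S T assume "S \<in> Pow I" "T \<in> Pow I" "V S = V T"
    then show "S = T"
      using e_in_V by blast
  qed
  then show ?thesis
    by (simp add: bands card_image card_Pow finite_I)
qed

subsection \<open>Facets in general position\<close>

text \<open>The last two assumptions express general position in dimension \<open>n + 1\<close>: any
  \<open>n\<close> functionals have a common nonzero zero, any \<open>n + 1\<close> do not.\<close>

locale general_position_cone = facet_cone +
  fixes n :: nat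
  assumes n_pos: "n \<ge> 1"
    and card_I: "card I = 2 * n"
    and few_zeros: "x \<in> X \<Longrightarrow> x \<noteq> 0 \<Longrightarrow> card {i \<in> I. f i x = 0} \<le> n"
    and common_zero: "S \<subseteq> I \<Longrightarrow> card S = n \<Longrightarrow> \<exists>v\<in>V S. v \<noteq> 0"
begin

lemma zeros_eq:
  assumes "S \<subseteq> I" "card S = n" "v \<in> V S" "v \<noteq> 0"
  shows "{i \<in> I. f i v = 0} = S"
proof -
  have "S \<subseteq> {i \<in> I. f i v = 0}" "v \<in> X"
    using assms by (auto simp: V_def)
  then show ?thesis
    using few_zeros[of v] assms finite_I by (intro card_seteq[symmetric]) auto
qed

lemma eq_0_if_many_zeros:
  assumes "x \<in> V S" "S \<subseteq> I" "card S > n"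
  shows "x = 0"
proof (rule ccontr)
  assume "x \<noteq> 0"
  moreover have "S \<subseteq> {i \<in> I. f i x = 0}"
    using assms by (auto simp: V_def)
  then have "card S \<le> card {i \<in> I. f i x = 0}"
    using finite_I by (intro card_mono) auto
  ultimately show False
    using few_zeros[of x] assms V_subset by fastforce
qed

lemma eq_0_if_all_zeros:
  assumes "x \<in> X" "\<And>i. i \<in> I \<Longrightarrow> f i x = 0"
  shows "x = 0"
  using eq_0_if_many_zeros[of x I] assms n_pos card_I by (auto simp: V_def)

text \<open>A single nonzero \<open>v\<close> in \<open>V S\<close> is already nonzero at every
  facet outside \<open>S\<close>.\<close>

lemma disjoint_complement_V:
  assumes "S \<subseteq> I" "card S = n"
  shows "disjoint_complement X K (V S) = V (I - S)"
proof -
  obtain v where v: "v \<in> V S" "v \<noteq> 0"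
    using common_zero assms by blast
  have "{i \<in> I. \<exists>x\<in>V S. f i x \<noteq> 0} = I - S"
    using zeros_eq[OF assms v] v(1) by (auto simp: V_def)
  then show ?thesis
    by (simp add: disjoint_complement_eq_V V_subset)
qed

text \<open>This is where the number \<open>2 * n\<close> of facets matters: \<open>V S\<close> and
  \<open>V (I - S)\<close> become disjoint complements of each other.\<close>

lemma card_complement: "S \<subseteq> I \<Longrightarrow> card S = n \<Longrightarrow> card (I - S) = n"
  using finite_I by (simp add: card_Diff_subset card_I finite_subset)

lemma V_in_bands:
  assumes "S \<subseteq> I" "card S = n"
  shows "V S \<in> bands X K"
proof -
  have "I - (I - S) = S" using assms by blast
  then show ?thesis
    using disjoint_complement_V[OF assms] disjoint_complement_V[of "I - S"] assms
    unfolding bands_def by (auto simp: card_complement subspace_V V_subset[THEN subsetD])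
qed

text \<open>Zeros of two disjoint nonzero elements cover all \<open>2 * n\<close> facets, while each of them has at
  most \<open>n\<close> zeros.\<close>

lemma disjoint_complement_cases:
  assumes "M \<subseteq> X"
  obtains "disjoint_complement X K M = {0}" | "disjoint_complement X K M = X"
  | S where "S \<subseteq> I" "card S = n" "disjoint_complement X K M = V S"
proof -
  define T where "T = {i \<in> I. \<exists>x\<in>M. f i x \<noteq> 0}"
  have T: "disjoint_complement X K M = V T"
    using disjoint_complement_eq_V[OF assms] by (simp add: T_def)
  consider "card T > n" | "card T = n" | "card T < n" by linarith
  then show thesis
  proof cases
    case 1
    then have "V T = {0}"
      using eq_0_if_many_zeros[of _ T] subspace_0[OF subspace_V] by (auto simp: T_def)
    then show ?thesis using that T by simp
  next
    case 2
    then show ?thesis using that(3)[of T] T by (auto simp: T_def)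
  next
    case 3
    \<comment> \<open>Each element of \<open>M\<close> vanishes off \<open>T\<close>, that is at
      more than \<open>n\<close> facets.\<close>
    have "x = 0" if "x \<in> M" for x
    proof (rule eq_0_if_many_zeros)
      show "x \<in> V (I - T)"
        using that assms by (auto simp: V_def T_def)
      show "card (I - T) > n"
        using 3 finite_I by (subst card_Diff_subset) (auto simp: T_def card_I)
    qed auto
    then have "T = {}"
      using linear_0[OF linear_f] by (auto simp: T_def)
    then have "V T = X"
      by (auto simp: V_def)
    then show ?thesis using that T by simp
  qed
qed

lemma X_in_bands: "X \<in> bands X K" and zero_in_bands: "{0} \<in> bands X K"
proof -
  have 0: "disjoint_complement X K {0} = X"
    using X_closed by (auto simp: disjoint_complement_eq_V V_def f_simps)
  \<comment> \<open>An element disjoint from all of \<open>X\<close> is disjoint from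
    itself.\<close>
  have "f i x * f i x = 0" if "x \<in> disjoint_complement X K X" "i \<in> I" for x i
    using that disjoint_elems_iff unfolding disjoint_complement_def by blast
  then have "x = 0" if "x \<in> disjoint_complement X K X" for x
    using that by (intro eq_0_if_all_zeros) (auto simp: disjoint_complement_def)
  moreover have "0 \<in> disjoint_complement X K X"
    by (simp add: disjoint_complement_eq_V subspace_0[OF subspace_V])
  ultimately have X: "disjoint_complement X K X = {0}"
    by blast
  show "X \<in> bands X K" "{0} \<in> bands X K"
    using 0 X subspace_X by (auto simp: bands_def X_closed subspace_single_0)
qed

lemma bands_eq: "bands X K = insert {0} (insert X (V ` {S. S \<subseteq> I \<and> card S = n}))"
proof (intro antisym subsetI)
  fix B assume "B \<in> bands X K"
  then have B: "disjoint_complement X K (disjoint_complement X K B) = B"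
    by (simp add: bands_def)
  have "disjoint_complement X K B \<subseteq> X"
    by (auto simp: disjoint_complement_def)
  then show "B \<in> insert {0} (insert X (V ` {S. S \<subseteq> I \<and> card S = n}))"
    by (rule disjoint_complement_cases) (simp_all add: B)
next
  fix B assume "B \<in> insert {0} (insert X (V ` {S. S \<subseteq> I \<and> card S = n}))"
  then show "B \<in> bands X K"
    using X_in_bands zero_in_bands V_in_bands by auto
qed

text \<open>Keeps the two trivial bands apart from the others: a nonzero element of
  \<open>V (I - S)\<close> vanishes nowhere on \<open>S\<close>, so it is outside
  \<open>V S\<close>.\<close>

lemma V_proper:
  assumes "S \<subseteq> I" "card S = n"
  shows "V S \<noteq> {0}" "V S \<noteq> X"
proof -
  show "V S \<noteq> {0}"
    using common_zero assms by blast
  obtain v where v: "v \<in> V (I - S)" "v \<noteq> 0"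
    using common_zero[of "I - S"] assms card_complement by blast
  obtain i where "i \<in> S"
    using assms n_pos by fastforce
  then have "f i v \<noteq> 0"
    using zeros_eq[OF _ _ v] assms card_complement by blast
  then show "V S \<noteq> X"
    using v \<open>i \<in> S\<close> by (auto simp: V_def)
qed

text \<open>The index set is recovered from \<open>V S\<close> as the zero set of any nonzero
  element; the summand 2 counts \<open>{0}\<close> and \<open>X\<close>.\<close>

lemma card_bands: "card (bands X K) = ((2 * n) choose n) + 2"
proof -
  let ?A = "{S. S \<subseteq> I \<and> card S = n}"
  have inj: "inj_on V ?A"
  proof (rule inj_onI)
    fix S T assume *: "S \<in> ?A" "T \<in> ?A" "V S = V T"
    then obtain v where v: "v \<in> V S" "v \<noteq> 0"
      using common_zero by blast
    have "{i \<in> I. f i v = 0} = S"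
      by (rule zeros_eq) (use * v in simp_all)
    moreover have "{i \<in> I. f i v = 0} = T"
      by (rule zeros_eq) (use * v in simp_all)
    ultimately show "S = T"
      by (rule trans[OF sym])
  qed
  have fin: "finite ?A"
    by (rule finite_subset[of _ "Pow I"]) (use finite_I in auto)
  have "card (V ` ?A) = (2 * n) choose n"
    unfolding card_image[OF inj] n_subsets[OF finite_I] card_I ..
  moreover have "X \<notin> V ` ?A"
    using V_proper(2) by (intro notI) (elim imageE CollectE conjE, metis)
  moreover have "{0} \<notin> insert X (V ` ?A)"
  proof -
    obtain S where S: "S \<subseteq> I" "card S = n"
      using card_I obtain_subset_with_card_n[of n I] by auto
    have "X \<noteq> {0}"
      using common_zero[OF S] V_subset[of S] by blast
    moreover have "{0} \<notin> V ` ?A"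
      using V_proper(1) by (intro notI) (elim imageE CollectE conjE, metis)
    ultimately show ?thesis by blast
  qed
  ultimately show ?thesis
    unfolding bands_eq using fin by (simp only: card_insert_disjoint finite_insert finite_imageI add_2_eq_Suc' not_False_eq_True)
qed

end

subsection \<open>Polynomials nonnegative at finitely many nodes\<close>

text \<open>\<open>coeff_space n\<close> consists of the coefficient sequences of the polynomials of degree at most \<open>n\<close>,
  and \<open>eval_at n i\<close> evaluates such a polynomial at \<open>i\<close>.\<close>

definition coeff_space :: "nat \<Rightarrow> (nat \<Rightarrow>\<^sub>0 real) set" where
  "coeff_space n = {x. \<forall>j>n. Poly_Mapping.lookup x j = 0}"

definition eval_at :: "nat \<Rightarrow> nat \<Rightarrow> (nat \<Rightarrow>\<^sub>0 real) \<Rightarrow> real" where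
  "eval_at n i x = (\<Sum>j\<le>n. Poly_Mapping.lookup x j * real i ^ j)"

text \<open>Products and powers of linear factors are formed in \<open>poly\<close>, where degrees
  and values are at hand, and then transferred.\<close>

definition of_poly :: "real poly \<Rightarrow> (nat \<Rightarrow>\<^sub>0 real)" where
  "of_poly q = Abs_poly_mapping (coeff q)"

lemma lookup_scaleR [simp]: "Poly_Mapping.lookup (c *\<^sub>R x) j = c *\<^sub>R Poly_Mapping.lookup x j"
  for x :: "'a \<Rightarrow>\<^sub>0 'b::real_vector"
proof -
  have "finite {i. c *\<^sub>R Poly_Mapping.lookup x i \<noteq> 0}"
    by (rule finite_subset[of _ "Poly_Mapping.keys x"]) (auto simp: in_keys_iff)
  then show ?thesis
    by (simp add: scaleR_poly_mapping_def)
qed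

lemma lookup_of_poly [simp]: "Poly_Mapping.lookup (of_poly q) j = coeff q j"
  using MOST_coeff_eq_0[of q] by (simp add: of_poly_def MOST_iff_cofinite)

lemma of_poly_in_coeff_space: "degree q \<le> n \<Longrightarrow> of_poly q \<in> coeff_space n"
  by (auto simp: coeff_space_def coeff_eq_0)

lemma eval_at_of_poly:
  assumes "degree q \<le> n"
  shows "eval_at n i (of_poly q) = poly q (real i)"
proof -
  have "(\<Sum>j\<le>n. coeff q j * real i ^ j) = (\<Sum>j\<le>degree q. coeff q j * real i ^ j)"
    using assms by (intro sum.mono_neutral_right) (auto simp: coeff_eq_0)
  then show ?thesis
    by (simp add: eval_at_def poly_altdef)
qed

lemma subspace_coeff_space: "subspace (coeff_space n)"
  by (auto simp: subspace_def coeff_space_def lookup_add)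

lemma linear_eval_at: "linear (eval_at n i)"
  by (rule linearI)
    (simp_all add: eval_at_def lookup_add distrib_right sum.distrib sum_distrib_left mult.assoc)

text \<open>Linearity does not suffice, since the ambient space is infinite dimensional. Its norm is
  the l1 norm, which bounds every coordinate.\<close>

lemma continuous_eval_at: "continuous_on S (eval_at n i)"
proof -
  have "\<bar>Poly_Mapping.lookup x j\<bar> \<le> norm x" for x :: "nat \<Rightarrow>\<^sub>0 real" and j
  proof (cases "j \<in> Poly_Mapping.keys x")
    case True
    then have "dist (Poly_Mapping.lookup x j) 0 \<le> norm x"
      unfolding norm_poly_mapping_def dist_poly_mapping_def
      by (auto intro!: member_le_sum)
    then show ?thesis by simp
  qed (simp add: in_keys_iff)
  then have "bounded_linear (\<lambda>x::nat \<Rightarrow>\<^sub>0 real. Poly_Mapping.lookup x j)" for j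
    by (intro bounded_linear_intro[where K = 1]) (auto simp: lookup_add)
  then have "continuous_on S (\<lambda>x. Poly_Mapping.lookup x j)" for j
    by (rule linear_continuous_on)
  then show ?thesis
    unfolding eval_at_def[abs_def] by (intro continuous_on_sum continuous_on_mult continuous_on_const)
qed

lemma dim_coeff_space: "dim (coeff_space n) = n + 1"
proof -
  define e :: "nat \<Rightarrow> (nat \<Rightarrow>\<^sub>0 real)" where "e i = Poly_Mapping.single i 1" for i
  have lookup_e: "Poly_Mapping.lookup (e i) j = (if i = j then 1 else 0)" for i j
    by (simp add: e_def lookup_single when_def)
  have inj: "inj e"
    by (rule injI) (metis lookup_e zero_neq_one)
  have lookup_sum: "Poly_Mapping.lookup (\<Sum>i\<le>n. g i *\<^sub>R e i) j = (if j \<le> n then g j else 0)" for g j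
    by (simp add: lookup_sum lookup_e if_distrib cong: if_cong)
  have indep: "independent (e ` {..n})"
  proof -
    have "u v = 0" if "(\<Sum>v\<in>e ` {..n}. u v *\<^sub>R v) = 0" "v \<in> e ` {..n}" for u v
    proof -
      obtain j where j: "j \<le> n" "v = e j" using \<open>v \<in> e ` {..n}\<close> by blast
      have "(\<Sum>i\<le>n. u (e i) *\<^sub>R e i) = 0"
        using that(1) inj by (simp add: sum.reindex inj_on_subset)
      then show ?thesis
        using lookup_sum[of "\<lambda>i. u (e i)" j] j by simp
    qed
    then show ?thesis
      by (auto simp: dependent_finite)
  qed
  have span: "coeff_space n \<subseteq> span (e ` {..n})"
  proof
    fix x assume "x \<in> coeff_space n"
    then have "x = (\<Sum>i\<le>n. Poly_Mapping.lookup x i *\<^sub>R e i)"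
      by (intro poly_mapping_eqI) (simp add: lookup_sum coeff_space_def)
    also have "\<dots> \<in> span (e ` {..n})"
      by (intro span_sum span_scale span_base) auto
    finally show "x \<in> span (e ` {..n})" .
  qed
  have "e ` {..n} \<subseteq> coeff_space n"
    by (auto simp: coeff_space_def lookup_e)
  moreover have "card (e ` {..n}) = n + 1"
    using inj by (simp add: card_image inj_on_subset)
  ultimately show ?thesis
    by (intro dim_unique[OF _ span indep])
qed

text \<open>The double root at \<open>i\<close> keeps \<open>facet_poly n i\<close> positive at all other nodes. It needs degree 2; for
  \<open>n = 1\<close> the only nodes are 0 and 1, where degree 1 suffices.\<close>

definition facet_poly :: "nat \<Rightarrow> nat \<Rightarrow> real poly" where
  "facet_poly n i = (if n = 1 then (if i = 0 then [:0, 1:] else [:1, -1:]) else [:- real i, 1:] ^ 2)"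

lemma degree_facet_poly: "n \<ge> 1 \<Longrightarrow> degree (facet_poly n i) \<le> n"
  by (auto simp: facet_poly_def degree_power_eq)

lemma general_position_eval_at:
  assumes "n \<ge> 1"
  shows "general_position_cone (coeff_space n) {..<2 * n} (eval_at n) (\<lambda>i. of_poly (facet_poly n i)) n"
proof -
  have eval: "eval_at n j (of_poly (facet_poly n i)) = poly (facet_poly n i) (real j)" for i j
    using assms by (intro eval_at_of_poly degree_facet_poly)
  interpret facet_cone "coeff_space n" "{..<2 * n}" "eval_at n" "\<lambda>i. of_poly (facet_poly n i)"
  proof
    fix i assume i: "i \<in> {..<2 * n}"
    show "of_poly (facet_poly n i) \<in> coeff_space n"
      using assms by (intro of_poly_in_coeff_space degree_facet_poly)
    show "eval_at n i (of_poly (facet_poly n i)) = 0"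
      using i unfolding eval by (auto simp: facet_poly_def)
    show "eval_at n j (of_poly (facet_poly n i)) > 0" if "j \<in> {..<2 * n}" "j \<noteq> i" for j
      using i that unfolding eval by (auto simp: facet_poly_def)
  qed (use subspace_coeff_space linear_add[OF linear_eval_at] linear_scale[OF linear_eval_at] in auto)
  show ?thesis
  proof
    show "n \<ge> 1" by fact
    show "card {..<2 * n} = 2 * n" by simp
    show "card {i \<in> {..<2 * n}. eval_at n i x = 0} \<le> n" if "x \<in> coeff_space n" "x \<noteq> 0" for x
    proof -
      \<comment> \<open>The nodes where \<open>x\<close> vanishes embed into the roots of a nonzero
        polynomial of degree at most \<open>n\<close>.\<close>
      let ?Z = "{z::real. (\<Sum>j\<le>n. Poly_Mapping.lookup x j * z ^ j) = 0}"
      have "\<exists>k\<le>n. Poly_Mapping.lookup x k \<noteq> 0"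
        using that by (metis (mono_tags, lifting) coeff_space_def lookup_zero mem_Collect_eq not_le
            poly_mapping_eqI)
      then have Z: "finite ?Z" "card ?Z \<le> n"
        using polyfun_rootbound[of n "Poly_Mapping.lookup x"] by auto
      have "card (real ` {i \<in> {..<2 * n}. eval_at n i x = 0}) \<le> card ?Z"
        using Z by (intro card_mono) (auto simp: eval_at_def)
      then show ?thesis
        using Z by (simp add: card_image inj_on_def)
    qed
    show "\<exists>v\<in>V S. v \<noteq> 0" if "S \<subseteq> {..<2 * n}" "card S = n" for S
    proof -
      \<comment> \<open>The monic polynomial with simple roots exactly at the nodes in
        \<open>S\<close>.\<close>
      define q where "q = (\<Prod>i\<in>S. [:- real i, 1:])"
      have S: "finite S" using that finite_subset by blast
      have "degree q \<le> n"
        unfolding q_def using degree_prod_sum_le[OF S, of "\<lambda>i. [:- real i, 1:]"] that by simp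
      moreover have "poly q (real i) = 0" if "i \<in> S" for i
        using that S by (auto simp: q_def poly_prod)
      ultimately have "of_poly q \<in> V S"
        by (auto simp: V_def of_poly_in_coeff_space eval_at_of_poly)
      moreover have "q \<noteq> 0"
        using S by (simp add: q_def)
      then have "of_poly q \<noteq> 0"
        by (metis leading_coeff_0_iff lookup_of_poly lookup_zero)
      ultimately show ?thesis by blast
    qed
  qed
qed

lemma ex_povs_central_binomial_bands:
  assumes "n \<ge> 1"
  shows "\<exists>X K :: (nat \<Rightarrow>\<^sub>0 real) set. povs X K \<and> dim X = n + 1 \<and>
    closedin (top_of_set X) K \<and> generating_cone X K \<and> polyhedral_cone X K \<and>
    card (bands X K) = ((2 * n) choose n) + 2"
proof -
  interpret general_position_cone "coeff_space n" "{..<2 * n}" "eval_at n"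
      "\<lambda>i. of_poly (facet_poly n i)" n
    using general_position_eval_at[OF assms] .
  have "K = coeff_space n \<inter> (\<Inter>i\<in>{..<2 * n}. {x. 0 \<le> eval_at n i x})"
    by (auto simp: K_def)
  moreover have "closed {x. 0 \<le> eval_at n i x}" for i
    by (intro closed_Collect_le continuous_eval_at continuous_on_const)
  then have "closed (\<Inter>i\<in>{..<2 * n}. {x. 0 \<le> eval_at n i x})"
    by (intro closed_INT) blast
  ultimately have "closedin (top_of_set (coeff_space n)) K"
    unfolding closedin_closed by blast
  \<comment> \<open>The constant polynomial 1 is positive at all nodes and serves as the order
    unit.\<close>
  moreover have one: "of_poly 1 \<in> coeff_space n" "eval_at n i (of_poly 1) > 0" for i
    by (simp_all add: of_poly_in_coeff_space eval_at_of_poly)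
  have "povs (coeff_space n) K"
    by (intro povs_K eq_0_if_all_zeros)
  moreover have "generating_cone (coeff_space n) K" "polyhedral_cone (coeff_space n) K"
    using generating_K[OF one(1)] polyhedral_K[OF one(1)] one(2) by blast+
  ultimately show ?thesis
    using dim_coeff_space[of n] card_bands by blast
qed

text \<open>The central binomial coefficient at least doubles from \<open>m\<close> to
  \<open>m + 1\<close>. The start is 20 > 16; for \<open>m = 2\<close> even two more bands give only
  6 + 2 = 8.\<close>

lemma central_binomial_gt_power2:
  assumes "m \<ge> 3"
  shows "2 ^ (m + 1) < (2 * m) choose m"
  using assms
proof (induction m rule: dec_induct)
  case base
  show ?case by (simp add: eval_nat_numeral)
next
  case (step m)
  have "N choose k \<le> Suc N choose k" for N k :: nat
    by (cases k) simp_all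
  then have "2 * ((2 * m) choose m) \<le> 2 * ((2 * m + 1) choose m)"
    by simp
  also have "2 * ((2 * m + 1) choose m) = (2 * Suc m) choose Suc m"
    using binomial_symmetric[of m "2 * m + 1"] by simp
  finally show ?case
    using step.IH by simp
qed

subsection \<open>Finite dimensional Archimedean vector lattices\<close>

locale archimedean_lattice =
  fixes Y L :: "'a::real_vector set"
  assumes lattice: "vector_lattice Y L" and archimedean: "archimedean_povs Y L"
begin

lemma povs: "povs Y L"
  using lattice by (simp add: vector_lattice_def)

lemma subspace_Y: "subspace Y" and L_subset: "L \<subseteq> Y"
  using povs by (auto simp: povs_def)

lemmas Y_closed = subspace_0[OF subspace_Y] subspace_add[OF subspace_Y]
  subspace_diff[OF subspace_Y] subspace_neg[OF subspace_Y] subspace_scale[OF subspace_Y]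

lemma in_Y: "x \<in> L \<Longrightarrow> x \<in> Y"
  using L_subset by blast

lemma L_add: "x \<in> L \<Longrightarrow> y \<in> L \<Longrightarrow> x + y \<in> L"
  and L_scale: "c \<ge> 0 \<Longrightarrow> x \<in> L \<Longrightarrow> c *\<^sub>R x \<in> L"
  and zero_in_L: "0 \<in> L"
  using povs by (auto simp: povs_def order_cone_def)

lemma L_antisym: "x \<in> L \<Longrightarrow> - x \<in> L \<Longrightarrow> x = 0"
  using povs unfolding povs_def order_cone_def by (metis IntI imageI minus_minus singletonD)

lemma L_sum: "(\<And>i. i \<in> F \<Longrightarrow> g i \<in> L) \<Longrightarrow> sum g F \<in> L"
  by (induction F rule: infinite_finite_induct) (auto intro: L_add zero_in_L)

lemma L_trans: "b - a \<in> L \<Longrightarrow> c - b \<in> L \<Longrightarrow> c - a \<in> L"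
  using L_add[of "b - a" "c - b"] by simp

text \<open>Scaling the limit hypothesis at 1/k by k shows that every multiple of \<open>- z\<close>
  lies below \<open>e\<close>; the Archimedean property then applies.\<close>

lemma L_closed_under_limits:
  assumes "z \<in> Y" "e \<in> L" and limit: "\<And>\<epsilon>. \<epsilon> > 0 \<Longrightarrow> z + \<epsilon> *\<^sub>R e \<in> L"
  shows "z \<in> L"
proof -
  have "e - real k *\<^sub>R (- z) \<in> L" for k
  proof (cases "k = 0")
    case False
    then have "real k *\<^sub>R (z + (1 / real k) *\<^sub>R e) \<in> L"
      by (intro L_scale limit) auto
    then show ?thesis
      using False by (simp add: algebra_simps)
  qed (simp add: assms)
  then have "- (- z) \<in> L"
    using archimedean assms in_Y Y_closed(4) unfolding archimedean_povs_def by blast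
  then show ?thesis by simp
qed

section \<open>Disjointness of positive elements\<close>

text \<open>For positive \<open>a\<close> and \<open>b\<close> this says that their infimum is 0,
  phrased by lower bounds so that no infimum has to be chosen.\<close>

definition disj :: "'a \<Rightarrow> 'a \<Rightarrow> bool" where
  "disj a b \<longleftrightarrow> (\<forall>c\<in>L. a - c \<in> L \<longrightarrow> b - c \<in> L \<longrightarrow> c = 0)"

lemma disj_commute: "disj a b \<longleftrightarrow> disj b a"
  by (auto simp: disj_def)

lemma disj_self: "a \<in> L \<Longrightarrow> disj a a \<Longrightarrow> a = 0"
  by (auto simp: disj_def zero_in_L)

lemma disj_mono: "disj a b \<Longrightarrow> b - b' \<in> L \<Longrightarrow> disj a b'"
  unfolding disj_def using L_trans by blast

lemma disj_zero: "disj a 0"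
  using L_antisym by (auto simp: disj_def)

text \<open>For a factor \<open>m\<close> of at least 1, a positive \<open>c\<close> below
  \<open>a\<close> and \<open>m *\<^sub>R b\<close> yields \<open>c\<close> divided by
  \<open>m\<close> below \<open>a\<close> and \<open>b\<close>. All smaller factors follow by
  monotonicity.\<close>

lemma disj_scale:
  assumes "disj a b" "a \<in> L" "b \<in> L"
  shows "disj a (k *\<^sub>R b)"
proof -
  define m where "m = max k 1"
  have m: "m \<ge> 1" "m \<ge> k" by (auto simp: m_def)
  have "disj a (m *\<^sub>R b)"
    unfolding disj_def
  proof (intro ballI impI)
    fix c assume c: "c \<in> L" "a - c \<in> L" "m *\<^sub>R b - c \<in> L"
    have "(a - c) + (1 - 1 / m) *\<^sub>R c \<in> L"
      using m c by (intro L_add L_scale) auto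
    then have "a - (1 / m) *\<^sub>R c \<in> L"
      by (simp add: algebra_simps)
    moreover have "(1 / m) *\<^sub>R (m *\<^sub>R b - c) \<in> L"
      using m c by (intro L_scale) auto
    then have "b - (1 / m) *\<^sub>R c \<in> L"
      using m by (simp add: algebra_simps)
    moreover have "(1 / m) *\<^sub>R c \<in> L"
      using m c by (intro L_scale) auto
    ultimately have "(1 / m) *\<^sub>R c = 0"
      using assms(1) unfolding disj_def by blast
    then show "c = 0"
      using m by simp
  qed
  moreover have "(m - k) *\<^sub>R b \<in> L"
    using m assms by (intro L_scale) auto
  ultimately show ?thesis
    using disj_mono by (simp add: scaleR_diff_left)
qed

lemma positive_part:
  assumes "x \<in> Y"
  obtains u where "u \<in> L" "u - x \<in> L" "\<And>w. w \<in> L \<Longrightarrow> w - x \<in> L \<Longrightarrow> w - u \<in> L"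
proof -
  obtain u where u: "u \<in> upper_bounds Y L {x, 0}" "\<forall>w\<in>upper_bounds Y L {x, 0}. w - u \<in> L"
    using lattice assms Y_closed(1) unfolding vector_lattice_def by blast
  show thesis
    by (rule that[of u]) (use u in_Y in \<open>auto simp: upper_bounds_def\<close>)
qed

text \<open>The positive and negative parts of \<open>x\<close>. Subtracting a common positive lower
  bound \<open>c\<close> from \<open>u\<close> leaves an upper bound of \<open>x\<close> and 0, so
  minimality of \<open>u\<close> forces \<open>c = 0\<close>.\<close>

lemma decomposition:
  assumes "x \<in> Y"
  obtains u v where "u \<in> L" "v \<in> L" "x = u - v" "disj u v"
    "\<And>w. w \<in> L \<Longrightarrow> w - x \<in> L \<Longrightarrow> w - u \<in> L" "\<And>w. w \<in> L \<Longrightarrow> w + x \<in> L \<Longrightarrow> w - v \<in> L"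
proof -
  obtain u where u: "u \<in> L" "u - x \<in> L" "\<And>w. w \<in> L \<Longrightarrow> w - x \<in> L \<Longrightarrow> w - u \<in> L"
    using positive_part[OF assms] by blast
  have "disj u (u - x)"
    unfolding disj_def
  proof (intro ballI impI)
    fix c assume c: "c \<in> L" "u - c \<in> L" "u - x - c \<in> L"
    then have "(u - c) - u \<in> L"
      using u(3)[of "u - c"] by (simp add: algebra_simps)
    then show "c = 0"
      using c L_antisym by simp
  qed
  moreover have "w - (u - x) \<in> L" if "w \<in> L" "w + x \<in> L" for w
    using u(3)[of "w + x"] that by (simp add: algebra_simps)
  ultimately show thesis
    using that[of u "u - x"] u by simp
qed

text \<open>For \<open>z\<close> below \<open>a\<close> and \<open>b + c\<close>, the positive part
  of \<open>z - b\<close> lies below \<open>a\<close> and \<open>c\<close>, so it is 0. Hence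
  \<open>z\<close> lies below \<open>b\<close> as well.\<close>

lemma disj_add:
  assumes "disj a b" "disj a c" "b \<in> L" "c \<in> L"
  shows "disj a (b + c)"
  unfolding disj_def
proof (intro ballI impI)
  fix z assume z: "z \<in> L" "a - z \<in> L" "b + c - z \<in> L"
  then have "z - b \<in> Y"
    using assms(3) by (simp add: Y_closed in_Y)
  then obtain s where s: "s \<in> L" "s - (z - b) \<in> L"
      "\<And>w. w \<in> L \<Longrightarrow> w - (z - b) \<in> L \<Longrightarrow> w - s \<in> L"
    using positive_part by blast
  have "c - s \<in> L"
    using s(3)[of c] z assms by (simp add: algebra_simps)
  moreover have "z - s \<in> L"
    using s(3)[of z] z assms by simp
  then have "a - s \<in> L"
    using z L_trans by blast
  ultimately have "s = 0"
    using assms(2) s(1) unfolding disj_def by blast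
  then have "b - z \<in> L"
    using s(2) by simp
  then show "z = 0"
    using assms(1) z unfolding disj_def by blast
qed

lemma disj_sum:
  "(\<And>i. i \<in> F \<Longrightarrow> g i \<in> L \<and> disj a (g i)) \<Longrightarrow> disj a (sum g F)"
  by (induction F rule: infinite_finite_induct) (auto intro: disj_add L_sum disj_zero)

section \<open>Linear independence of disjoint families\<close>

definition disjoint_family :: "'a set \<Rightarrow> bool" where
  "disjoint_family E \<longleftrightarrow> finite E \<and> E \<subseteq> L \<and> 0 \<notin> E \<and> pairwise disj E"

text \<open>If \<open>u v\<close> were positive, solving the relation for
  \<open>u v *\<^sub>R v\<close> would place it below \<open>b\<close>, from which it is
  disjoint.\<close>

lemma disjoint_family_coeff_nonpos:
  assumes E: "disjoint_family E" and "v \<in> E" and sum0: "(\<Sum>e\<in>E. u e *\<^sub>R e) = 0"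
  shows "u v \<le> 0"
proof (rule ccontr)
  assume "\<not> u v \<le> 0"
  then have uv: "u v > 0" by simp
  have vL: "v \<in> L" "v \<noteq> 0" "finite E"
    using assms by (auto simp: disjoint_family_def)
  define b where "b = (\<Sum>e\<in>E - {v}. \<bar>u e\<bar> *\<^sub>R e)"
  have "disj v b"
    unfolding b_def
  proof (rule disj_sum)
    fix e assume "e \<in> E - {v}"
    then have "e \<in> L" "disj v e"
      using E \<open>v \<in> E\<close> by (auto simp: disjoint_family_def pairwise_def)
    then show "\<bar>u e\<bar> *\<^sub>R e \<in> L \<and> disj v (\<bar>u e\<bar> *\<^sub>R e)"
      using vL by (auto intro: L_scale disj_scale)
  qed
  moreover have bL: "b \<in> L"
    unfolding b_def using E by (intro L_sum L_scale) (auto simp: disjoint_family_def)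
  ultimately have disj: "disj (u v *\<^sub>R v) b"
    using disj_scale[of b v "u v"] vL disj_commute by blast
  have "(\<Sum>e\<in>E. u e *\<^sub>R e) = u v *\<^sub>R v + (\<Sum>e\<in>E - {v}. u e *\<^sub>R e)"
    using \<open>v \<in> E\<close> vL by (simp add: sum.remove)
  then have "u v *\<^sub>R v = - (\<Sum>e\<in>E - {v}. u e *\<^sub>R e)"
    using sum0 by (simp add: add_eq_0_iff2)
  then have "b - u v *\<^sub>R v = (\<Sum>e\<in>E - {v}. (\<bar>u e\<bar> + u e) *\<^sub>R e)"
    by (simp add: b_def sum.distrib scaleR_add_left)
  also have "\<dots> \<in> L"
    using E by (intro L_sum L_scale) (auto simp: disjoint_family_def)
  finally have "u v *\<^sub>R v = 0"
    using disj[unfolded disj_def, rule_format, of "u v *\<^sub>R v"] L_scale[of "u v" v] uv vL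
    by (simp add: zero_in_L)
  then show False
    using uv vL by simp
qed

lemma independent_disjoint_family:
  assumes "disjoint_family E"
  shows "independent E"
proof -
  have "u v = 0" if "(\<Sum>e\<in>E. u e *\<^sub>R e) = 0" "v \<in> E" for u v
  proof (rule antisym)
    show "u v \<le> 0"
      using disjoint_family_coeff_nonpos[OF assms] that by blast
    have "(\<Sum>e\<in>E. (- u e) *\<^sub>R e) = 0"
      using that by (simp add: sum_negf)
    then show "u v \<ge> 0"
      using disjoint_family_coeff_nonpos[OF assms, of v "\<lambda>e. - u e"] that by simp
  qed
  then show ?thesis
    using assms by (auto simp: dependent_finite disjoint_family_def)
qed

text \<open>No two nonzero disjoint elements lie below multiples of \<open>e\<close>. By the Archimedean property the
  elements below \<open>e\<close> are then multiples of \<open>e\<close>.\<close>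

definition atom :: "'a \<Rightarrow> bool" where
  "atom e \<longleftrightarrow> e \<in> L \<and> e \<noteq> 0 \<and>
     (\<forall>u\<in>L. \<forall>v\<in>L. \<forall>k\<ge>0. k *\<^sub>R e - u \<in> L \<longrightarrow> k *\<^sub>R e - v \<in> L \<longrightarrow> disj u v \<longrightarrow> u = 0 \<or> v = 0)"

text \<open>The positive and negative parts of \<open>x - c *\<^sub>R e\<close> are disjoint and lie
  below \<open>(1 + abs c) *\<^sub>R e\<close>, so one of them is 0.\<close>

lemma atom_comparable:
  assumes "atom e" "x \<in> L" "e - x \<in> L"
  shows "x - c *\<^sub>R e \<in> L \<or> c *\<^sub>R e - x \<in> L"
proof -
  have eL: "e \<in> L" using assms by (simp add: atom_def)
  then have "x - c *\<^sub>R e \<in> Y"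
    using assms(2) by (simp add: Y_closed in_Y)
  then obtain u v where uv: "u \<in> L" "v \<in> L" "x - c *\<^sub>R e = u - v" "disj u v"
    "\<And>w. w \<in> L \<Longrightarrow> w - (x - c *\<^sub>R e) \<in> L \<Longrightarrow> w - u \<in> L"
    "\<And>w. w \<in> L \<Longrightarrow> w + (x - c *\<^sub>R e) \<in> L \<Longrightarrow> w - v \<in> L"
    using decomposition by blast
  define k where "k = 1 + \<bar>c\<bar>"
  have kL: "k *\<^sub>R e \<in> L"
    using eL by (auto simp: k_def intro: L_scale)
  have "(e - x) + (\<bar>c\<bar> + c) *\<^sub>R e \<in> L"
    using assms eL by (intro L_add L_scale) auto
  then have "k *\<^sub>R e - (x - c *\<^sub>R e) \<in> L"
    by (simp add: k_def algebra_simps)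
  then have "k *\<^sub>R e - u \<in> L"
    using uv(5) kL by blast
  moreover have "x + (1 + \<bar>c\<bar> - c) *\<^sub>R e \<in> L"
    using assms eL by (intro L_add L_scale) auto
  then have "k *\<^sub>R e + (x - c *\<^sub>R e) \<in> L"
    by (simp add: k_def algebra_simps)
  then have "k *\<^sub>R e - v \<in> L"
    using uv(6) kL by blast
  moreover have "k \<ge> 0"
    by (simp add: k_def)
  ultimately have "u = 0 \<or> v = 0"
    using assms(1) uv unfolding atom_def by blast
  moreover have "c *\<^sub>R e - x = v - u"
    using uv(3) by (metis minus_diff_eq)
  ultimately show ?thesis
    using uv(1-3) by auto
qed

text \<open>The Archimedean property is used twice: it bounds the admissible factors, and it shows
  that their supremum is admissible.\<close>

lemma largest_multiple_below:
  assumes "e \<in> L" "e \<noteq> 0" "y \<in> L"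
  obtains c where "c \<ge> 0" "y - c *\<^sub>R e \<in> L" "\<And>d. y - d *\<^sub>R e \<in> L \<Longrightarrow> d \<le> c"
proof -
  define A where "A = {c. y - c *\<^sub>R e \<in> L}"
  have down: "d \<in> A" if "c \<in> A" "d \<le> c" for c d
  proof -
    have "(y - c *\<^sub>R e) + (c - d) *\<^sub>R e \<in> L"
      using that assms by (intro L_add L_scale) (auto simp: A_def)
    then show ?thesis
      by (simp add: A_def algebra_simps)
  qed
  have "bdd_above A"
  proof (rule ccontr)
    assume "\<not> bdd_above A"
    then have "\<exists>c\<in>A. real k < c" for k
      unfolding bdd_above_def by (meson not_le)
    then have "y - real k *\<^sub>R e \<in> L" for k
      using down[of _ "real k"] by (auto simp: A_def intro: less_imp_le)
    then have "- e \<in> L"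
      using archimedean assms in_Y unfolding archimedean_povs_def by blast
    then show False
      using L_antisym assms by blast
  qed
  moreover have A0: "0 \<in> A"
    using assms by (simp add: A_def)
  ultimately have upper: "c \<le> Sup A" if "c \<in> A" for c
    using that by (intro cSup_upper)
  have "y - Sup A *\<^sub>R e \<in> L"
  proof (rule L_closed_under_limits)
    fix \<epsilon> :: real assume "\<epsilon> > 0"
    then obtain c where "c \<in> A" "Sup A - \<epsilon> < c"
      using less_cSupD[of A "Sup A - \<epsilon>"] A0 by auto
    then have "Sup A - \<epsilon> \<in> A"
      using down by simp
    then show "y - Sup A *\<^sub>R e + \<epsilon> *\<^sub>R e \<in> L"
      by (simp add: A_def algebra_simps)
  qed (use assms in \<open>simp_all add: Y_closed in_Y\<close>)
  then show thesis
    using that[of "Sup A"] upper A0 by (simp add: A_def)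
qed

text \<open>For the largest \<open>c\<close>, no \<open>c + \<epsilon>\<close> is admissible, so
  comparability puts \<open>x\<close> below \<open>(c + \<epsilon>) *\<^sub>R e\<close>; let
  \<open>\<epsilon>\<close> tend to 0.\<close>

lemma atom_multiple:
  assumes "atom e" "x \<in> L" "e - x \<in> L"
  obtains c where "c \<ge> 0" "x = c *\<^sub>R e"
proof -
  have e: "e \<in> L" "e \<noteq> 0"
    using assms by (auto simp: atom_def)
  obtain c where c: "c \<ge> 0" "x - c *\<^sub>R e \<in> L" "\<And>d. x - d *\<^sub>R e \<in> L \<Longrightarrow> d \<le> c"
    using largest_multiple_below[OF e assms(2)] by blast
  have "c *\<^sub>R e - x \<in> L"
  proof (rule L_closed_under_limits)
    fix \<epsilon> :: real assume "\<epsilon> > 0"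
    then have "x - (c + \<epsilon>) *\<^sub>R e \<notin> L"
      using c(3) by fastforce
    then show "c *\<^sub>R e - x + \<epsilon> *\<^sub>R e \<in> L"
      using atom_comparable[OF assms, of "c + \<epsilon>"] by (simp add: algebra_simps)
  qed (use assms e in \<open>simp_all add: Y_closed in_Y\<close>)
  then have "x - c *\<^sub>R e = 0"
    using c(2) by (intro L_antisym) simp_all
  then show thesis
    using that[of c] c by simp
qed

text \<open>A common positive lower bound of \<open>e\<close> and the remainder is a multiple of
  \<open>e\<close> and could be added to the largest one.\<close>

lemma subtract_atom:
  assumes "atom e" "y \<in> L"
  obtains c where "c \<ge> 0" "y - c *\<^sub>R e \<in> L" "disj e (y - c *\<^sub>R e)"
proof -
  have e: "e \<in> L" "e \<noteq> 0"
    using assms by (auto simp: atom_def)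
  obtain c where c: "c \<ge> 0" "y - c *\<^sub>R e \<in> L" "\<And>d. y - d *\<^sub>R e \<in> L \<Longrightarrow> d \<le> c"
    using largest_multiple_below[OF e assms(2)] by blast
  have "disj e (y - c *\<^sub>R e)"
    unfolding disj_def
  proof (intro ballI impI)
    fix z assume z: "z \<in> L" "e - z \<in> L" "y - c *\<^sub>R e - z \<in> L"
    then obtain d where d: "d \<ge> 0" "z = d *\<^sub>R e"
      using atom_multiple assms by blast
    then have "c + d \<le> c"
      using z by (intro c(3)) (simp add: algebra_simps)
    then show "z = 0"
      using d by simp
  qed
  then show thesis
    using that c by blast
qed

text \<open>Subtracting a further atom only shrinks the remainder, which keeps it disjoint from the
  atoms already treated.\<close>

lemma subtract_atoms:
  assumes "finite F" "\<And>e. e \<in> F \<Longrightarrow> atom e" "y \<in> L"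
  shows "\<exists>g. (\<forall>e\<in>F. g e \<ge> 0) \<and> y - (\<Sum>e\<in>F. g e *\<^sub>R e) \<in> L \<and>
    (\<forall>e\<in>F. disj e (y - (\<Sum>e\<in>F. g e *\<^sub>R e)))"
  using assms(1,2)
proof (induction F rule: finite_induct)
  case empty
  then show ?case using assms by simp
next
  case (insert a F)
  then obtain g where g: "\<forall>e\<in>F. g e \<ge> 0" "y - (\<Sum>e\<in>F. g e *\<^sub>R e) \<in> L"
    "\<forall>e\<in>F. disj e (y - (\<Sum>e\<in>F. g e *\<^sub>R e))"
    by auto
  define y' where "y' = y - (\<Sum>e\<in>F. g e *\<^sub>R e)"
  obtain c where c: "c \<ge> 0" "y' - c *\<^sub>R a \<in> L" "disj a (y' - c *\<^sub>R a)"
    using subtract_atom[of a y'] insert g by (auto simp: y'_def)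
  have "y' - (y' - c *\<^sub>R a) \<in> L"
    using c insert.prems by (auto simp: atom_def intro: L_scale)
  then have disj: "disj e (y' - c *\<^sub>R a)" if "e \<in> F" for e
    using g that disj_mono unfolding y'_def by blast
  have "(\<Sum>e\<in>F. (g(a := c)) e *\<^sub>R e) = (\<Sum>e\<in>F. g e *\<^sub>R e)"
    using insert by (intro sum.cong) auto
  then have "y - (\<Sum>e\<in>insert a F. (g(a := c)) e *\<^sub>R e) = y' - c *\<^sub>R a"
    using insert by (simp add: y'_def algebra_simps del: fun_upd_apply) simp
  then show ?case
    using c disj g by (intro exI[of _ "g(a := c)"]) (auto simp del: sum.insert)
qed

section \<open>Maximal disjoint families and positive bases\<close>

lemma maximal_disjoint_family:
  assumes "dim Y > 0"
  obtains E where "disjoint_family E" "\<And>E'. disjoint_family E' \<Longrightarrow> card E' \<le> card E"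
proof -
  obtain B where B: "B \<subseteq> Y" "Y \<subseteq> span B" "card B = dim Y"
    by (rule basis_exists[of Y])
  \<comment> \<open>An infinite basis would have \<open>card\<close> equal to 0.\<close>
  then have "finite B"
    using assms by (intro card_ge_0_finite) (simp only:)
  have "card E < Suc (card B)" if "disjoint_family E" for E
    using independent_span_bound[OF \<open>finite B\<close> independent_disjoint_family[OF that]]
      that B L_subset by (auto simp: disjoint_family_def less_Suc_eq_le)
  moreover have "disjoint_family {}"
    by (simp add: disjoint_family_def)
  ultimately show thesis
    using ex_has_greatest_nat[of disjoint_family "{}" card "Suc (card B)"] that by blast
qed

lemma disjoint_family_insert:
  assumes "disjoint_family E" "z \<in> L" "z \<noteq> 0" "\<And>e. e \<in> E \<Longrightarrow> disj z e"
  shows "disjoint_family (insert z E)" "card (insert z E) = Suc (card E)"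
proof -
  have "z \<notin> E"
    using assms disj_self by blast
  then show "card (insert z E) = Suc (card E)"
    using assms by (simp add: disjoint_family_def)
  show "disjoint_family (insert z E)"
    using assms disj_commute by (auto simp: disjoint_family_def pairwise_insert)
qed

text \<open>Otherwise replacing \<open>e\<close> by two disjoint elements below multiples of \<open>e\<close> enlarges the family.\<close>

lemma atoms_of_maximal_family:
  assumes E: "disjoint_family E" and max: "\<And>E'. disjoint_family E' \<Longrightarrow> card E' \<le> card E"
    and "e \<in> E"
  shows "atom e"
proof -
  have e: "e \<in> L" "e \<noteq> 0"
    using E \<open>e \<in> E\<close> by (auto simp: disjoint_family_def)
  have "u = 0 \<or> v = 0"
    if uv: "u \<in> L" "v \<in> L" "k \<ge> 0" "k *\<^sub>R e - u \<in> L" "k *\<^sub>R e - v \<in> L" "disj u v" for u v k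
  proof (rule ccontr)
    assume nz: "\<not> (u = 0 \<or> v = 0)"
    have disj_below: "disj w a" if "k *\<^sub>R e - w \<in> L" "a \<in> E - {e}" for w a
    proof -
      have "a \<in> L" "disj a e"
        using E that \<open>e \<in> E\<close> by (auto simp: disjoint_family_def pairwise_def)
      then show ?thesis
        using disj_mono[OF disj_scale] e that disj_commute by blast
    qed
    have "disjoint_family (E - {e})"
      using E by (auto simp: disjoint_family_def pairwise_def)
    then have 1: "disjoint_family (insert v (E - {e}))"
        "card (insert v (E - {e})) = Suc (card (E - {e}))"
      using disjoint_family_insert[of "E - {e}" v] uv nz disj_below by auto
    have "disjoint_family (insert u (insert v (E - {e})))"
        "card (insert u (insert v (E - {e}))) = Suc (card (insert v (E - {e})))"
      using disjoint_family_insert[OF 1(1), of u] uv nz disj_below by auto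
    moreover have "card E = Suc (card (E - {e}))"
      using E \<open>e \<in> E\<close> by (intro card.remove) (auto simp: disjoint_family_def)
    ultimately show False
      using max[of "insert u (insert v (E - {e}))"] 1(2) by linarith
  qed
  then show ?thesis
    using e unfolding atom_def by blast
qed

text \<open>What remains of a positive element after subtracting the atoms is disjoint from
  \<open>E\<close>; if nonzero, it would enlarge the maximal family.\<close>

lemma ex_positive_basis:
  assumes "dim Y > 0"
  obtains E where "finite E" "independent E" "span E = Y"
    "L = {\<Sum>e\<in>E. g e *\<^sub>R e | g. \<forall>e\<in>E. g e \<ge> 0}"
proof -
  obtain E where E: "disjoint_family E" and max: "\<And>E'. disjoint_family E' \<Longrightarrow> card E' \<le> card E"
    using maximal_disjoint_family[OF assms] by blast
  have EL: "E \<subseteq> L" "finite E"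
    using E by (auto simp: disjoint_family_def)
  have combination: "\<exists>g. (\<forall>e\<in>E. g e \<ge> 0) \<and> y = (\<Sum>e\<in>E. g e *\<^sub>R e)" if "y \<in> L" for y
  proof -
    obtain g where g: "\<forall>e\<in>E. g e \<ge> 0" "y - (\<Sum>e\<in>E. g e *\<^sub>R e) \<in> L"
      "\<forall>e\<in>E. disj e (y - (\<Sum>e\<in>E. g e *\<^sub>R e))"
      using subtract_atoms[of E y] atoms_of_maximal_family[OF E max] EL \<open>y \<in> L\<close> by blast
    have "y - (\<Sum>e\<in>E. g e *\<^sub>R e) = 0"
    proof (rule ccontr)
      assume "y - (\<Sum>e\<in>E. g e *\<^sub>R e) \<noteq> 0"
      from disjoint_family_insert[OF E g(2) this] g(3) show False
        using max[of "insert (y - (\<Sum>e\<in>E. g e *\<^sub>R e)) E"] disj_commute by fastforce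
    qed
    then show ?thesis
      using g by auto
  qed
  moreover have "(\<Sum>e\<in>E. g e *\<^sub>R e) \<in> L" if "\<forall>e\<in>E. g e \<ge> 0" for g
    using that EL by (intro L_sum L_scale) auto
  ultimately have L: "L = {\<Sum>e\<in>E. g e *\<^sub>R e | g. \<forall>e\<in>E. g e \<ge> 0}"
    by blast
  have "L \<subseteq> span E"
    unfolding L by (auto intro: span_sum span_scale span_base)
  then have "Y \<subseteq> span E"
    using decomposition by (metis span_diff subsetD subsetI)
  moreover have "span E \<subseteq> Y"
    using EL L_subset by (intro span_minimal subspace_Y) auto
  ultimately show thesis
    using that EL L independent_disjoint_family[OF E] by blast
qed

end

text \<open>The coordinate functionals of a positive basis present \<open>L\<close> as a facet cone,
  with the basis as dual system.\<close>

lemma card_bands_archimedean_vector_lattice: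
  fixes Y L :: "'a::real_vector set"
  assumes "vector_lattice Y L" "archimedean_povs Y L" "dim Y > 0"
  shows "card (bands Y L) = 2 ^ dim Y"
proof -
  interpret archimedean_lattice Y L
    using assms by unfold_locales
  obtain E where E: "finite E" "independent E" "span E = Y"
    and L: "L = {\<Sum>e\<in>E. g e *\<^sub>R e | g. \<forall>e\<in>E. g e \<ge> 0}"
    using ex_positive_basis[OF assms(3)] by blast
  have "\<forall>e. \<exists>G. linear G \<and> (\<forall>x\<in>E. G x = (if x = e then 1 else 0 :: real))"
    by (intro allI linear_independent_extend E(2))
  then obtain G where G: "\<And>e. linear (G e)"
      "\<And>e x. x \<in> E \<Longrightarrow> G e x = (if x = e then 1 else 0 :: real)"
    by metis
  have G_sum: "G e (\<Sum>x\<in>F. g x *\<^sub>R x) = (if e \<in> F then g e else 0)" if "F \<subseteq> E" for e F g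
  proof -
    have "G e (\<Sum>x\<in>F. g x *\<^sub>R x) = (\<Sum>x\<in>F. g x * G e x)"
      by (simp add: linear_sum[OF G(1)] linear_scale[OF G(1)])
    also have "\<dots> = (\<Sum>x\<in>F. if x = e then g x else 0)"
      using G(2) that by (intro sum.cong) auto
    finally show ?thesis
      using that E by (simp add: finite_subset)
  qed
  \<comment> \<open>The sum of the other basis vectors has coordinate 0 at \<open>e\<close> and 1
    elsewhere.\<close>
  interpret facet_cone Y E G "\<lambda>e. \<Sum>x\<in>E - {e}. x"
  proof
    fix e assume "e \<in> E"
    show "(\<Sum>x\<in>E - {e}. x) \<in> Y"
      unfolding E(3)[symmetric] by (auto intro: span_sum span_base)
    show "G e (\<Sum>x\<in>E - {e}. x) = 0"
      using G_sum[of "E - {e}" e "\<lambda>_. 1"] by simp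
    show "G j (\<Sum>x\<in>E - {e}. x) > 0" if "j \<in> E" "j \<noteq> e" for j
      using G_sum[of "E - {e}" j "\<lambda>_. 1"] that by simp
  qed (use subspace_Y E linear_add[OF G(1)] linear_scale[OF G(1)] in auto)
  have "K = L"
  proof
    show "K \<subseteq> L"
    proof
      fix x assume x: "x \<in> K"
      then obtain h where h: "x = (\<Sum>e\<in>E. h e *\<^sub>R e)"
        using E K_subset by (auto simp: span_finite)
      then have "\<forall>e\<in>E. h e \<ge> 0"
        using x G_sum[OF order_refl, of _ h] by (simp add: K_def)
      then show "x \<in> L"
        unfolding L h by blast
    qed
    show "L \<subseteq> K"
    proof
      fix x assume "x \<in> L"
      then obtain g where "x = (\<Sum>e\<in>E. g e *\<^sub>R e)" "\<forall>e\<in>E. g e \<ge> 0"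
        unfolding L by blast
      then show "x \<in> K"
        using G_sum[OF order_refl, of _ g] in_Y[OF \<open>x \<in> L\<close>] by (simp add: K_def)
    qed
  qed
  moreover have "dim Y = card E"
    using E(3) dim_eq_card_independent[OF E(2)] dim_span[of E] by simp
  moreover have "card (bands Y K) = 2 ^ card E"
    using E(3) span_superset[of E] G(2) by (intro card_bands_pow[of "\<lambda>e. e"]) auto
  ultimately show ?thesis by simp
qed

(* The ambient space of finitely supported real sequences contains spaces of every finite
   dimension. The dim of an infinite dimensional space is 0, so dim X = m with m > 0 forces X
   to be finite dimensional. Likewise card of an infinite set is 0, so a positive card (bands X K)
   forces the set of bands to be finite. *)
theorem mainTheorem3:
  shows "(\<forall>n\<ge>1. \<exists>X K :: (nat \<Rightarrow>\<^sub>0 real) set.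
            povs X K \<and> dim X = n + 1 \<and>
            closedin (top_of_set X) K \<and> generating_cone X K \<and> polyhedral_cone X K \<and>
            card (bands X K) = ((2 * n) choose n) + 2) \<and>
         (\<forall>n\<ge>4. \<exists>X K :: (nat \<Rightarrow>\<^sub>0 real) set.
            povs X K \<and> dim X = n \<and> 2 ^ n < card (bands X K) \<and>
            (\<forall>Y L :: 'b::real_vector set.
               vector_lattice Y L \<and> archimedean_povs Y L \<and> dim Y = n \<longrightarrow>
               card (bands Y L) = 2 ^ n \<and> card (bands Y L) < card (bands X K)))"
proof (intro conjI allI impI)
  fix n :: nat assume "n \<ge> 1"
  then show "\<exists>X K :: (nat \<Rightarrow>\<^sub>0 real) set. povs X K \<and> dim X = n + 1 \<and>
      closedin (top_of_set X) K \<and> generating_cone X K \<and> polyhedral_cone X K \<and>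
      card (bands X K) = ((2 * n) choose n) + 2"
    by (rule ex_povs_central_binomial_bands)
next
  fix n :: nat assume n: "n \<ge> 4"
  \<comment> \<open>The construction for \<open>m\<close> has dimension
    \<open>m + 1\<close>.\<close>
  define m where "m = n - 1"
  have m: "m \<ge> 3" "n = m + 1"
    using n by (auto simp: m_def)
  obtain X K :: "(nat \<Rightarrow>\<^sub>0 real) set" where XK: "povs X K" "dim X = n"
    "card (bands X K) = ((2 * m) choose m) + 2"
    using ex_povs_central_binomial_bands[of m] m by auto
  have less: "2 ^ n < card (bands X K)"
    using central_binomial_gt_power2[of m] m XK(3) by simp
  have "card (bands Y L) = 2 ^ n"
    if "vector_lattice Y L \<and> archimedean_povs Y L \<and> dim Y = n" for Y L :: "'b set"
    using card_bands_archimedean_vector_lattice[of Y L] that n by simp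
  then show "\<exists>X K :: (nat \<Rightarrow>\<^sub>0 real) set. povs X K \<and> dim X = n \<and> 2 ^ n < card (bands X K) \<and>
      (\<forall>Y L :: 'b set. vector_lattice Y L \<and> archimedean_povs Y L \<and> dim Y = n \<longrightarrow>
        card (bands Y L) = 2 ^ n \<and> card (bands Y L) < card (bands X K))"
    using XK less by (intro exI[of _ X] exI[of _ K]) simp
qed

end
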